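(* For every integer $n\ge 0$, \[ B_{n,\lambda}(x)=\sum_{k=0}^{n}(1)_{k,\lambda}\Big(\frac{x}{1+\lambda x}\Big)^{k}{n \brace k}_{\lambda}. \] In particular, for $x=1$ (assuming $1+\lambda>0$), \[ B_{n,\lambda}=B_{n,\lambda}(1)=\sum_{k=0}^{n}(1)_{k,\lambda}\Big(\frac{1}{1+\lambda}\Big)^{k}{n \brace k}_{\lambda}. \]
   Context: Let $\lambda$ be a fixed nonzero real number. The degenerate falling factorial is $(x)_{0,\lambda}=1$ and $(x)_{n,\lambda}=x(x-\lambda)\cdots(x-(n-1)\lambda)$ for $n\ge1$. The degenerate exponential is $e_\lambda^{x}(t)=(1+\lambda t)^{x/\lambda}=\sum_{n\ge0}(x)_{n,\lambda}\frac{t^n}{n!}$, and $e_\lambda(t)=e_\lambda^1(t)$. The degenerate Stirling numbers of the second kind ${n\brace k}_\lambda$ are defined by $\frac{1}{k!}(e_\lambda(t)-1)^k=\sum_{n\ge k}{n\brace k}_\lambda\frac{t^n}{n!}$ for $k\ge0$ (and ${n\brace k}_\lambda=0$ for $n<k$). Let $x$ be real with $1+\lambda x>0$, so $e_\lambda(x)=(1+\lambda x)^{1/\lambda}$ is defined. The fully degenerate Bell polynomials $B_{n,\lambda}(x)$ are defined by the formal power series identity in $t$ \[ \frac{1}{e_\lambda(x)}\,e_\lambda\big(x e_\lambda(t)\big)=\sum_{n=0}^\infty B_{n,\lambda}(x)\frac{t^n}{n!},\qquad e_\lambda\big(xe_\lambda(t)\big)=\big(1+\lambda x e_\lambda(t)\big)^{1/\lambda}.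 \] *)

theory Defs
  imports Complex_Main "HOL-Computational_Algebra.Formal_Power_Series"
begin

unbundle fps_syntax

text \<open>The degenerate falling factorial \<open>(x)\<^sub>n\<^sub>,\<^sub>l = x (x - l) \<dots> (x - (n - 1) l)\<close>.\<close>

definition degen_ffact :: "real \<Rightarrow> real \<Rightarrow> nat \<Rightarrow> real" where
  "degen_ffact l x n = (\<Prod>i<n. x - of_nat i * l)"

text \<open>The number \<open>(1 + l x)\<^bsup>1/l\<^esup>\<close>, meaningful for \<open>l \<noteq> 0\<close> and \<open>1 + l x > 0\<close>.\<close>

definition degen_exp :: "real \<Rightarrow> real \<Rightarrow> real" where
  "degen_exp l x = (1 + l * x) powr (1 / l)"

text \<open>
  The formal power series in \<open>t\<close> of \<open>(1 + l t)\<^bsup>x/l\<^esup>\<close>; lemma \<open>degen_exp_fps_eq_powr\<close> below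
  justifies the name.
\<close>

definition degen_exp_fps :: "real \<Rightarrow> real \<Rightarrow> real fps" where
  "degen_exp_fps l x = Abs_fps (\<lambda>n. degen_ffact l x n / fact n)"

text \<open>
  Real powers of a formal power series with positive constant term \<open>c\<close>, by Newton's binomial
  series \<open>(c + u)\<^sup>a = (\<Sum>m. (a choose m) c\<^bsup>a-m\<^esup> u\<^sup>m)\<close>. This is needed because \<open>fps_binomial\<close>
  only handles constant term 1. The lemmas \<open>fps_powr_nth_0\<close> and \<open>fps_powr_deriv\<close> determine
  the series uniquely.
\<close>

definition fps_powr :: "real fps \<Rightarrow> real \<Rightarrow> real fps" where
  "fps_powr F a =
     Abs_fps (\<lambda>m. (a gchoose m) * (F $ 0) powr (a - of_nat m)) oo (F - fps_const (F $ 0))"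

lemma fps_powr_nth_0: "fps_powr F a $ 0 = (F $ 0) powr a"
  by (simp add: fps_powr_def)

lemma fps_powr_deriv:
  assumes "F $ 0 > 0"
  shows "F * fps_deriv (fps_powr F a) = fps_const a * fps_deriv F * fps_powr F a"
proof -
  define c where "c = F $ 0"
  define G where "G = Abs_fps (\<lambda>m. (a gchoose m) * c powr (a - of_nat m))"
  define U where "U = F - fps_const c"
  have c: "c > 0" and U: "U $ 0 = 0"
    using assms by (simp_all add: c_def U_def)
  have "(fps_const c + fps_X) * fps_deriv G = fps_const a * G"
  proof (rule fps_ext)
    fix m
    have *: "c * c powr (a - (1 + real m)) = c powr (a - real m)"
      using c powr_add[of c 1 "a - (1 + real m)"] by simp
    have **: "(a gchoose Suc m) * (1 + real m) = (a gchoose m) * (a - real m)"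
      using gbinomial_absorb_comp[of a m] gbinomial_absorption[of m a]
      by (simp add: algebra_simps)
    have "c * ((1 + real m) * ((a gchoose Suc m) * c powr (a - (1 + real m))))
        = ((a gchoose Suc m) * (1 + real m)) * (c * c powr (a - (1 + real m)))"
      by (simp only: mult_ac)
    also have "\<dots> = (a - real m) * ((a gchoose m) * c powr (a - real m))"
      by (simp only: * ** mult_ac)
    finally have "c * fps_deriv G $ m = (a - real m) * G $ m"
      by (simp add: G_def add_ac)
    moreover have "(fps_X * fps_deriv G) $ m = real m * G $ m"
      by (cases m) (simp_all add: G_def)
    ultimately show "((fps_const c + fps_X) * fps_deriv G) $ m = (fps_const a * G) $ m"
      by (simp add: distrib_right algebra_simps)
  qed
  then have "((fps_const c + fps_X) * fps_deriv G) oo U = (fps_const a * G) oo U"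
    by simp
  then have "F * (fps_deriv G oo U) = fps_const a * (G oo U)"
    using U by (simp add: fps_compose_mult_distrib fps_compose_add_distrib U_def)
  moreover have "fps_deriv (G oo U) = (fps_deriv G oo U) * fps_deriv F"
    using U by (simp add: fps_compose_deriv) (simp add: U_def)
  ultimately have "F * fps_deriv (G oo U) = fps_const a * fps_deriv F * (G oo U)"
    by (metis mult.assoc mult.commute)
  then show ?thesis
    by (simp add: fps_powr_def G_def U_def c_def)
qed

lemma degen_exp_fps_eq_powr:
  assumes "l \<noteq> 0"
  shows "degen_exp_fps l x = fps_powr (1 + fps_const l * fps_X) (x / l)"
proof (rule fps_ext)
  fix n
  have "l ^ n * (x / l gchoose n) = (\<Prod>i<n. (x / l - real i) * l) / fact n"
    by (simp add: gbinomial_prod_rev prod.distrib lessThan_atLeast0 mult.commute)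
  also have "(\<Prod>i<n. (x / l - real i) * l) = degen_ffact l x n"
    using assms by (simp add: degen_ffact_def left_diff_distrib)
  finally show "degen_exp_fps l x $ n = fps_powr (1 + fps_const l * fps_X) (x / l) $ n"
    by (simp add: degen_exp_fps_def fps_powr_def fps_compose_linear)
qed

text \<open>
  Coefficient of \<open>t\<^sup>n / n!\<close> in \<open>(e\<^sub>l(t) - 1)\<^sup>k / k!\<close>; it vanishes for \<open>n < k\<close>.
\<close>

definition degen_stirling :: "real \<Rightarrow> nat \<Rightarrow> nat \<Rightarrow> real" where
  "degen_stirling l n k =
     fact n * (fps_const (1 / fact k) * (degen_exp_fps l 1 - 1) ^ k) $ n"

text \<open>
  Coefficient of \<open>t\<^sup>n / n!\<close> in \<open>(1 + l x e\<^sub>l(t))\<^bsup>1/l\<^esup> / e\<^sub>l(x)\<close>.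
\<close>

definition degen_bell :: "real \<Rightarrow> nat \<Rightarrow> real \<Rightarrow> real" where
  "degen_bell l n x =
     fact n * (fps_const (1 / degen_exp l x) *
               fps_powr (1 + fps_const (l * x) * degen_exp_fps l 1) (1 / l)) $ n"

definition degen_bell_number :: "real \<Rightarrow> nat \<Rightarrow> real" where
  "degen_bell_number l n = degen_bell l n 1"

end

theory Submission
  imports Defs
begin

text \<open>
  The constant term of \<open>1 + l x e\<^sub>l(t)\<close> is \<open>c = 1 + l x\<close>, so by Newton's binomial series
  \<open>(1 + l x e\<^sub>l(t))\<^bsup>1/l\<^esup> = (\<Sum>k. (1/l choose k) c\<^bsup>1/l-k\<^esup> (l x)\<^sup>k (e\<^sub>l(t) - 1)\<^sup>k)\<close>. Division by
  \<open>e\<^sub>l(x) = c\<^bsup>1/l\<^esup>\<close> leaves the coefficients \<open>(1/l choose k) l\<^sup>k (x/c)\<^sup>k\<close>, and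
  \<open>k! (1/l choose k) l\<^sup>k = (1)\<^sub>k\<^sub>,\<^sub>l\<close>.
\<close>

text \<open>Each of the \<open>n\<close> numerator factors of the binomial absorbs one
  \<open>l\<close>: \<open>(x / l - i) * l = x - i * l\<close>.\<close>

lemma degen_ffact_eq_gbinomial:
  assumes "l \<noteq> 0"
  shows "degen_ffact l x n = fact n * l ^ n * (x / l gchoose n)"
proof -
  have "fact n * l ^ n * (x / l gchoose n) = (\<Prod>i<n. (x / l - real i) * l)"
    by (simp add: gbinomial_prod_rev prod.distrib lessThan_atLeast0 mult.commute)
  also have "\<dots> = degen_ffact l x n"
    using assms by (simp add: degen_ffact_def left_diff_distrib)
  finally show ?thesis by simp
qed

lemma degen_bell_eq_sum_stirling:
  assumes l: "l \<noteq> 0" and pos: "1 + l * x > 0"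
  shows "degen_bell l n x =
    (\<Sum>k=0..n. degen_ffact l 1 k * (x / (1 + l * x)) ^ k * degen_stirling l n k)"
proof -
  define c where "c = 1 + l * x"
  define E where "E = degen_exp_fps l 1"
  define F where "F = 1 + fps_const (l * x) * E"
  have c: "c > 0" using pos by (simp add: c_def)
  have "E $ 0 = 1"
    by (simp add: E_def degen_exp_fps_def degen_ffact_def)
  then have F0: "F $ 0 = c"
    by (simp add: F_def c_def)
  have "fps_const c = 1 + fps_const (l * x)"
    by (simp add: c_def flip: fps_const_add)
  then have "F - fps_const c = fps_const (l * x) * (E - 1)"
    by (simp add: F_def algebra_simps)
  then have U: "(F - fps_const c) ^ k = fps_const ((l * x) ^ k) * (E - 1) ^ k" for k
    by (simp only: power_mult_distrib fps_const_power)
  \<comment> \<open>As \<open>c > 0\<close>, \<open>c powr (1 / l - k)\<close> splits into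
    \<open>c powr (1 / l) / c ^ k\<close>.\<close>
  have coeff: "1 / c powr (1 / l) * ((1 / l gchoose k) * c powr (1 / l - real k) * (l * x) ^ k) =
      degen_ffact l 1 k * (x / c) ^ k / fact k" for k
    using c by (simp add: degen_ffact_eq_gbinomial[OF l] powr_diff powr_realpow
        power_mult_distrib power_divide)
  have "degen_bell l n x = fact n * (1 / c powr (1 / l) * fps_powr F (1 / l) $ n)"
    by (simp add: degen_bell_def degen_exp_def c_def F_def E_def)
  \<comment> \<open>The sum stops at \<open>n\<close> since \<open>E - 1\<close> has zero constant
    term.\<close>
  also have "fps_powr F (1 / l) $ n =
      (\<Sum>k=0..n. (1 / l gchoose k) * c powr (1 / l - real k) * (l * x) ^ k * ((E - 1) ^ k) $ n)"
    by (simp add: fps_powr_def fps_compose_nth F0 U mult.assoc)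
  also have "fact n * (1 / c powr (1 / l) * \<dots>) =
      (\<Sum>k=0..n. fact n * ((1 / c powr (1 / l) *
         ((1 / l gchoose k) * c powr (1 / l - real k) * (l * x) ^ k)) * ((E - 1) ^ k) $ n))"
    by (simp only: sum_distrib_left mult.assoc)
  \<comment> \<open>The \<open>1 / fact k\<close> from \<open>coeff\<close> and the
    \<open>fact n\<close> complete the Stirling number.\<close>
  also have "\<dots> = (\<Sum>k=0..n. degen_ffact l 1 k * (x / c) ^ k * degen_stirling l n k)"
    unfolding coeff by (simp add: degen_stirling_def E_def mult_ac)
  finally show ?thesis by (simp only: c_def)
qed

theorem theorem2p1:
  fixes l :: real
  assumes "l \<noteq> 0"
  shows "(\<forall>(x::real) (n::nat). 1 + l * x > 0 \<longrightarrow>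
            degen_bell l n x =
              (\<Sum>k=0..n. degen_ffact l 1 k * (x / (1 + l * x)) ^ k * degen_stirling l n k))
       \<and> (\<forall>n::nat. 1 + l > 0 \<longrightarrow>
            degen_bell_number l n = degen_bell l n 1 \<and>
            degen_bell l n 1 =
              (\<Sum>k=0..n. degen_ffact l 1 k * (1 / (1 + l)) ^ k * degen_stirling l n k))"
  using assms degen_bell_eq_sum_stirling[of l 1]
  by (simp add: degen_bell_eq_sum_stirling degen_bell_number_def)

end
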